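(* Let $\{(u_k,x_k,w_k,y_k,\tau_k)\}_{k\ge1}$ be generated by Algorithm 1 (described in the context), under the standing assumption. Assume that $(x^\star,w^\star,y^\star)$ is a saddle point of $\mathbb{L}$ and that $c>0$ satisfies $c\ge 2\|y^\star\|$. Let $k_1\in\mathbb{N}$ be the index described in the context. Then there exists $C_1>0$ such that for all $N\ge k_1$ $$\big|\Phi(\tilde x_N,\tilde w_N)-\Phi^\star\big|\le\frac{C_1}{N'}\qquad\text{and}\qquad \|A\tilde x_N+B\tilde w_N-b\|\le\frac{2C_1}{c\,N'},$$ where $$\tilde x_N:=\frac1{N'}\sum_{k=k_1}^N x_k,\qquad \tilde w_N:=\frac1{N'}\sum_{k=k_1}^N w_k,\qquad N':=N-k_1+1.$$
   Context: **Problem.** $g:\mathbb{R}^q\to\mathbb{R}\cup\{+\infty\}$ and $f:\mathbb{R}^p\to\mathbb{R}\cup\{+\infty\}$ are proper, closed, convex functions, $A\in\mathbb{R}^{m\times q}$, $B\in\mathbb{R}^{m\times p}$, $b\in\mathbb{R}^m$. The problem is $\min_{x\in\mathbb{R}^q,\,w\in\mathbb{R}^p} g(x)+f(w)$ subject to $Ax+Bw=b$. Set $\Phi(x,w):=g(x)+f(w)$, $\Phi^\star:=\min\{\Phi(x,w):Ax+Bw=b\}$, $\mathbb{L}(x,w,y):=\Phi(x,w)+\langle y,Ax+Bw-b\rangle$ and, for $\sigma>0$, $\mathbb{L}_\sigma(x,w,y):=\mathbb{L}(x,w,y)+\frac{\sigma}{2}\|Ax+Bw-b\|^2$. A triple $(x^\star,w^\star,y^\star)$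 is a saddle point of $\mathbb{L}$ if $\mathbb{L}(x^\star,w^\star,y)\le\mathbb{L}(x^\star,w^\star,y^\star)\le\mathbb{L}(x,w,y^\star)$ for all $(x,w,y)\in\mathbb{R}^q\times\mathbb{R}^p\times\mathbb{R}^m$. **Standing assumption.** The solution set of the problem is nonempty, and there exist $\tilde x\in\operatorname{ri}(\operatorname{dom} g)$ and $\tilde w\in\operatorname{ri}(\operatorname{dom} f)$ with $A\tilde x+B\tilde w=b$ ($\operatorname{ri}$ = relative interior). **Notation.** $\mathbb{N}=\{1,2,\dots\}$. $\|\cdot\|$ is the Euclidean norm. For a symmetric positive semidefinite $M$, $\|y\|_M:=\sqrt{y^\top My}$. $\lambda_{\min}(M)$ is the smallest eigenvalue of $M$. $\varphi:=\frac{1+\sqrt5}{2}$. **Algorithm 1.** Let $S\in\mathbb{R}^{q\times q}$ and $T\in\mathbb{R}^{p\times p}$ be symmetric positive definite, $x_0\in\mathbb{R}^q$, $w_0\in\mathbb{R}^p$, $y_0\in\mathbb{R}^m$, $u_0=x_0$, $\tau_0>0$, $\beta>0$, $\psi\in(1,\varphi]$, $0<\mu<\frac{\psi}{2}$. For $k=1,2,\dots$: $$u_k=\tfrac{\psi-1}{\psi}x_{k-1}+\tfrac1\psi u_{k-1},\qquad x_k=\arg\min_x\Big\{\mathbb{L}(x,w_{k-1},y_{k-1})+\tfrac{1}{2\tau_{k-1}}\|x-u_k\|_S^2\Big\},$$ $$\tau_k=\min\Big\{\tau_{k-1},\frac{\mu\sqrt{\lambda_{\min}(S)}}{\sqrt\beta\,L_k}\Big\},\qquad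 L_k:=\frac{\|Ax_k-Ax_{k-1}\|}{\|x_k-x_{k-1}\|},$$ with the convention that $\tau_k=\tau_{k-1}$ whenever $Ax_k=Ax_{k-1}$ (in particular whenever $x_k=x_{k-1}$), $$w_k=\arg\min_w\Big\{\mathbb{L}_{\beta\tau_k}(x_k,w,y_{k-1})+\tfrac12\|w-w_{k-1}\|_T^2\Big\},\qquad y_k=y_{k-1}+\beta\tau_k(Ax_k+Bw_k-b).$$ **The index $k_1$.** With $T_k:=\tau_kT$, $k_1\in\mathbb{N}$ is a natural number such that for all $k\ge k_1$ and all $y\in\mathbb{R}^m$ $$\begin{aligned}2\tau_k\big(\mathbb{L}(x_k,w_k,y)-\Phi^\star\big)\le{}&\tfrac{\psi}{\psi-1}\big(\|u_{k+1}-x^\star\|_S^2-\|u_{k+2}-x^\star\|_S^2\big)+\big(\|w^\star-w_{k-1}\|_{T_{k-1}}^2-\|w^\star-w_k\|_{T_k}^2\big)\\&+\tfrac1\beta\big(\|y-y_{k-1}\|^2-\|y-y_k\|^2\big)-\|w_k-w_{k-1}\|_{T_k}^2\\&-\tfrac1\beta(1-\mu)\|y_k-y_{k-1}\|^2-\tfrac{\psi\tau_k}{\tau_{k-1}}\|x_k-u_{k+1}\|_S^2.\end{aligned}$$ Such a $k_1$ always exists. *)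

theory Defs
  imports "HOL-Analysis.Analysis"
begin

section \<open>Extended-real-valued convex functions\<close>

definition effdom :: "('a \<Rightarrow> ereal) \<Rightarrow> 'a set" where
  "effdom h = {z. h z < \<infinity>}"

text \<open>The library's \<^const>\<open>epigraph\<close> is restricted to real-valued functions.\<close>

definition ereal_epigraph :: "('a \<Rightarrow> ereal) \<Rightarrow> ('a \<times> real) set" where
  "ereal_epigraph h = {(z, r). h z \<le> ereal r}"

definition proper_fun :: "('a \<Rightarrow> ereal) \<Rightarrow> bool" where
  "proper_fun h \<longleftrightarrow> (\<forall>z. h z \<noteq> -\<infinity>) \<and> effdom h \<noteq> {}"

definition closed_fun :: "('a::topological_space \<Rightarrow> ereal) \<Rightarrow> bool" where
  "closed_fun h \<longleftrightarrow> closed (ereal_epigraph h)"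

definition convex_fun :: "('a::real_vector \<Rightarrow> ereal) \<Rightarrow> bool" where
  "convex_fun h \<longleftrightarrow> convex (ereal_epigraph h)"

section \<open>Matrices\<close>

definition sym_pos_def :: "real ^ 'n ^ 'n \<Rightarrow> bool" where
  "sym_pos_def M \<longleftrightarrow> transpose M = M \<and> (\<forall>v. v \<noteq> 0 \<longrightarrow> 0 < v \<bullet> (M *v v))"

definition wnorm :: "real ^ 'n ^ 'n \<Rightarrow> real ^ 'n \<Rightarrow> real" where
  "wnorm M v = sqrt (v \<bullet> (M *v v))"

definition eigvals :: "real ^ 'n ^ 'n \<Rightarrow> real set" where
  "eigvals M = {l. \<exists>v. v \<noteq> 0 \<and> M *v v = l *\<^sub>R v}"

text \<open>For symmetric \<open>M\<close> the set of real eigenvalues is finite and nonempty, so that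
  \<^const>\<open>Min\<close> is meaningful.\<close>

definition lambda_min :: "real ^ 'n ^ 'n \<Rightarrow> real" where
  "lambda_min M = Min (eigvals M)"

section \<open>The problem and its Lagrangians\<close>

definition Phi :: "(real ^ 'q \<Rightarrow> ereal) \<Rightarrow> (real ^ 'p \<Rightarrow> ereal) \<Rightarrow> real ^ 'q \<Rightarrow> real ^ 'p \<Rightarrow> ereal" where
  "Phi g f x w = g x + f w"

definition feasible :: "real ^ 'q ^ 'm \<Rightarrow> real ^ 'p ^ 'm \<Rightarrow> real ^ 'm \<Rightarrow> ((real ^ 'q) \<times> (real ^ 'p)) set" where
  "feasible A B b = {(x, w). A *v x + B *v w = b}"

definition Phi_star ::
  "(real ^ 'q \<Rightarrow> ereal) \<Rightarrow> (real ^ 'p \<Rightarrow> ereal) \<Rightarrow> real ^ 'q ^ 'm \<Rightarrow> real ^ 'p ^ 'm \<Rightarrow> real ^ 'm \<Rightarrow> ereal" where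
  "Phi_star g f A B b = (INF (x, w) \<in> feasible A B b. Phi g f x w)"

definition solutions ::
  "(real ^ 'q \<Rightarrow> ereal) \<Rightarrow> (real ^ 'p \<Rightarrow> ereal) \<Rightarrow> real ^ 'q ^ 'm \<Rightarrow> real ^ 'p ^ 'm \<Rightarrow> real ^ 'm
    \<Rightarrow> ((real ^ 'q) \<times> (real ^ 'p)) set" where
  "solutions g f A B b = {(x, w) \<in> feasible A B b. Phi g f x w = Phi_star g f A B b}"

definition Lagr ::
  "(real ^ 'q \<Rightarrow> ereal) \<Rightarrow> (real ^ 'p \<Rightarrow> ereal) \<Rightarrow> real ^ 'q ^ 'm \<Rightarrow> real ^ 'p ^ 'm \<Rightarrow> real ^ 'm
    \<Rightarrow> real ^ 'q \<Rightarrow> real ^ 'p \<Rightarrow> real ^ 'm \<Rightarrow> ereal" where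
  "Lagr g f A B b x w y = Phi g f x w + ereal (y \<bullet> (A *v x + B *v w - b))"

definition aug_Lagr ::
  "(real ^ 'q \<Rightarrow> ereal) \<Rightarrow> (real ^ 'p \<Rightarrow> ereal) \<Rightarrow> real ^ 'q ^ 'm \<Rightarrow> real ^ 'p ^ 'm \<Rightarrow> real ^ 'm
    \<Rightarrow> real \<Rightarrow> real ^ 'q \<Rightarrow> real ^ 'p \<Rightarrow> real ^ 'm \<Rightarrow> ereal" where
  "aug_Lagr g f A B b \<sigma> x w y =
     Lagr g f A B b x w y + ereal (\<sigma> / 2 * (norm (A *v x + B *v w - b))\<^sup>2)"

definition saddle_point ::
  "(real ^ 'q \<Rightarrow> ereal) \<Rightarrow> (real ^ 'p \<Rightarrow> ereal) \<Rightarrow> real ^ 'q ^ 'm \<Rightarrow> real ^ 'p ^ 'm \<Rightarrow> real ^ 'm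
    \<Rightarrow> real ^ 'q \<Rightarrow> real ^ 'p \<Rightarrow> real ^ 'm \<Rightarrow> bool" where
  "saddle_point g f A B b xs ws ys \<longleftrightarrow>
     (\<forall>x w y. Lagr g f A B b xs ws y \<le> Lagr g f A B b xs ws ys \<and>
              Lagr g f A B b xs ws ys \<le> Lagr g f A B b x w ys)"

definition standing_assumption ::
  "(real ^ 'q \<Rightarrow> ereal) \<Rightarrow> (real ^ 'p \<Rightarrow> ereal) \<Rightarrow> real ^ 'q ^ 'm \<Rightarrow> real ^ 'p ^ 'm \<Rightarrow> real ^ 'm \<Rightarrow> bool" where
  "standing_assumption g f A B b \<longleftrightarrow>
     solutions g f A B b \<noteq> {} \<and>
     (\<exists>x \<in> rel_interior (effdom g). \<exists>w \<in> rel_interior (effdom f). A *v x + B *v w = b)"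

section \<open>The algorithm\<close>

definition L_ratio :: "real ^ 'q ^ 'm \<Rightarrow> (nat \<Rightarrow> real ^ 'q) \<Rightarrow> nat \<Rightarrow> real" where
  "L_ratio A x k = norm (A *v x k - A *v x (k - 1)) / norm (x k - x (k - 1))"

text \<open>The starting data are \<open>x 0\<close>, \<open>w 0\<close>, \<open>y 0\<close>, \<open>\<tau> 0\<close>. Each \<open>arg min\<close> is rendered by
  \<^const>\<open>is_arg_min\<close>, i.e. the next iterate is a global minimizer of the subproblem. The
  objective of the first subproblem contains the constant \<open>f (w (k - 1))\<close>; if \<open>w 0\<close> lies outside
  the domain of \<open>f\<close>, it is constantly \<open>\<infinity>\<close> for \<open>k = 1\<close> and then \<open>x 1\<close> is unconstrained
  (in particular, it may be the minimizer of the subproblem with that constant dropped).\<close>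

definition algorithm1 ::
  "(real ^ 'q \<Rightarrow> ereal) \<Rightarrow> (real ^ 'p \<Rightarrow> ereal) \<Rightarrow> real ^ 'q ^ 'm \<Rightarrow> real ^ 'p ^ 'm \<Rightarrow> real ^ 'm
    \<Rightarrow> real ^ 'q ^ 'q \<Rightarrow> real ^ 'p ^ 'p \<Rightarrow> real \<Rightarrow> real \<Rightarrow> real
    \<Rightarrow> (nat \<Rightarrow> real ^ 'q) \<Rightarrow> (nat \<Rightarrow> real ^ 'q) \<Rightarrow> (nat \<Rightarrow> real ^ 'p) \<Rightarrow> (nat \<Rightarrow> real ^ 'm)
    \<Rightarrow> (nat \<Rightarrow> real) \<Rightarrow> bool" where
  "algorithm1 g f A B b S T \<beta> \<psi> \<mu> u x w y \<tau> \<longleftrightarrow>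
     sym_pos_def S \<and> sym_pos_def T \<and> \<tau> 0 > 0 \<and> \<beta> > 0 \<and>
     1 < \<psi> \<and> \<psi> \<le> (1 + sqrt 5) / 2 \<and> 0 < \<mu> \<and> \<mu> < \<psi> / 2 \<and>
     u 0 = x 0 \<and>
     (\<forall>k \<ge> 1.
        u k = ((\<psi> - 1) / \<psi>) *\<^sub>R x (k - 1) + (1 / \<psi>) *\<^sub>R u (k - 1) \<and>
        is_arg_min
          (\<lambda>z. Lagr g f A B b z (w (k - 1)) (y (k - 1))
                + ereal (1 / (2 * \<tau> (k - 1)) * (wnorm S (z - u k))\<^sup>2))
          (\<lambda>_. True) (x k) \<and>
        \<tau> k = (if A *v x k = A *v x (k - 1) then \<tau> (k - 1)
               else min (\<tau> (k - 1)) (\<mu> * sqrt (lambda_min S) / (sqrt \<beta> * L_ratio A x k))) \<and>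
        is_arg_min
          (\<lambda>z. aug_Lagr g f A B b (\<beta> * \<tau> k) (x k) z (y (k - 1))
                + ereal (1 / 2 * (wnorm T (z - w (k - 1)))\<^sup>2))
          (\<lambda>_. True) (w k) \<and>
        y k = y (k - 1) + (\<beta> * \<tau> k) *\<^sub>R (A *v x k + B *v w k - b))"

text \<open>The defining property of the index \<open>k1\<close>, relative to a saddle point with primal part
  \<open>(xs, ws)\<close>. The weighted norms with index \<open>T_k\<close> use the matrix \<open>\<tau> k *\<^sub>R T\<close>.\<close>

definition index_k1 ::
  "(real ^ 'q \<Rightarrow> ereal) \<Rightarrow> (real ^ 'p \<Rightarrow> ereal) \<Rightarrow> real ^ 'q ^ 'm \<Rightarrow> real ^ 'p ^ 'm \<Rightarrow> real ^ 'm
    \<Rightarrow> real ^ 'q ^ 'q \<Rightarrow> real ^ 'p ^ 'p \<Rightarrow> real \<Rightarrow> real \<Rightarrow> real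
    \<Rightarrow> (nat \<Rightarrow> real ^ 'q) \<Rightarrow> (nat \<Rightarrow> real ^ 'q) \<Rightarrow> (nat \<Rightarrow> real ^ 'p) \<Rightarrow> (nat \<Rightarrow> real ^ 'm)
    \<Rightarrow> (nat \<Rightarrow> real) \<Rightarrow> real ^ 'q \<Rightarrow> real ^ 'p \<Rightarrow> nat \<Rightarrow> bool" where
  "index_k1 g f A B b S T \<beta> \<psi> \<mu> u x w y \<tau> xs ws k1 \<longleftrightarrow>
     k1 \<ge> 1 \<and>
     (\<forall>k \<ge> k1. \<forall>v.
        ereal (2 * \<tau> k) * (Lagr g f A B b (x k) (w k) v - Phi_star g f A B b) \<le>
        ereal (
          \<psi> / (\<psi> - 1) * ((wnorm S (u (k + 1) - xs))\<^sup>2 - (wnorm S (u (k + 2) - xs))\<^sup>2)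
          + ((wnorm (\<tau> (k - 1) *\<^sub>R T) (ws - w (k - 1)))\<^sup>2 - (wnorm (\<tau> k *\<^sub>R T) (ws - w k))\<^sup>2)
          + 1 / \<beta> * ((norm (v - y (k - 1)))\<^sup>2 - (norm (v - y k))\<^sup>2)
          - (wnorm (\<tau> k *\<^sub>R T) (w k - w (k - 1)))\<^sup>2
          - 1 / \<beta> * (1 - \<mu>) * (norm (y k - y (k - 1)))\<^sup>2
          - \<psi> * \<tau> k / \<tau> (k - 1) * (wnorm S (x k - u (k + 1)))\<^sup>2))"

definition avg :: "nat \<Rightarrow> (nat \<Rightarrow> 'a::real_vector) \<Rightarrow> nat \<Rightarrow> 'a" where
  "avg k1 z N = (1 / real (N - k1 + 1)) *\<^sub>R (\<Sum>k = k1..N. z k)"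

end

theory Submission
  imports Defs
begin

text \<open>Taking \<open>v = y\<^sup>\<star>\<close> in the inequality defining \<open>k\<^sub>1\<close>, its left-hand side is nonnegative, so the
  potential
  \<open>\<psi>/(\<psi>-1) \<parallel>u\<^sub>k\<^sub>+\<^sub>1 - x\<^sup>\<star>\<parallel>\<^sub>S\<^sup>2 + \<tau>\<^sub>k\<^sub>-\<^sub>1 \<parallel>w\<^sup>\<star> - w\<^sub>k\<^sub>-\<^sub>1\<parallel>\<^sub>T\<^sup>2 + \<parallel>v - y\<^sub>k\<^sub>-\<^sub>1\<parallel>\<^sup>2/\<beta>\<close>
  is nonincreasing for \<open>v = y\<^sup>\<star>\<close>. So \<open>y\<^sub>k\<close> is bounded, and the potential is bounded uniformly in \<open>k\<close>
  and \<open>\<parallel>v\<parallel> \<le> c\<close>. Since \<open>\<tau>\<^sub>k\<close> is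
  nonincreasing and bounded away from \<open>0\<close> (because \<open>L\<^sub>k\<close> is at most the operator norm of \<open>A\<close> and
  \<open>\<lambda>\<^sub>m\<^sub>i\<^sub>n(S) > 0\<close>), dividing by \<open>2\<tau>\<^sub>k\<close> and summing by parts bounds the sum of the Lagrangian gaps
  by a constant. Jensen's inequality gives an \<open>O(1/N')\<close> bound on the gap at the averages, for
  all \<open>\<parallel>v\<parallel> \<le> c\<close>. The choice of \<open>v\<close> parallel to the residual then yields both estimates,
  the lower one through the saddle point and \<open>c \<ge> 2\<parallel>y\<^sup>\<star>\<parallel>\<close>.\<close>

section \<open>Eigenvalues of symmetric matrices\<close>

lemma inner_matrix_symmetric:
  fixes S :: "real ^ 'n ^ 'n"
  assumes "transpose S = S"
  shows "v \<bullet> (S *v w) = (S *v v) \<bullet> w"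
  using dot_lmul_matrix[of v S w] assms by (metis matrix_transpose_mul transpose_matrix_vector)

text \<open>Eigenvectors for distinct eigenvalues are orthogonal, hence independent, so the
  dimension bounds their number.\<close>

lemma finite_eigvals:
  fixes S :: "real ^ 'n ^ 'n"
  assumes "transpose S = S"
  shows "finite (eigvals S)"
proof -
  have "\<forall>l\<in>eigvals S. \<exists>v. v \<noteq> 0 \<and> S *v v = l *\<^sub>R v" by (simp add: eigvals_def)
  then obtain v where v: "\<And>l. l \<in> eigvals S \<Longrightarrow> v l \<noteq> 0 \<and> S *v v l = l *\<^sub>R v l"
    by metis
  have orth: "v l \<bullet> v l' = 0" if "l \<in> eigvals S" "l' \<in> eigvals S" "l \<noteq> l'" for l l'
    using inner_matrix_symmetric[OF assms, of "v l" "v l'"] v[OF that(1)] v[OF that(2)] that(3)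
    by simp
  have inj: "inj_on v (eigvals S)"
    using orth v by (metis inj_onI inner_eq_zero_iff)
  have "pairwise orthogonal (v ` eigvals S)"
    unfolding pairwise_def orthogonal_def using orth by blast
  moreover have "0 \<notin> v ` eigvals S" using v by force
  ultimately have "finite (v ` eigvals S)"
    using independent_imp_finite pairwise_orthogonal_independent by blast
  then show ?thesis using inj finite_imageD by blast
qed

text \<open>A minimizer of the Rayleigh quotient is an eigenvector.\<close>

lemma eigvals_nonempty:
  fixes S :: "real ^ 'n ^ 'n"
  assumes sym: "transpose S = S"
  shows "eigvals S \<noteq> {}"
proof -
  let ?q = "\<lambda>z. z \<bullet> (S *v z)"
  have "continuous_on (sphere 0 1) ?q"
    by (intro continuous_intros linear_continuous_on matrix_vector_mul_bounded_linear)
  moreover have "(axis undefined 1 :: real ^ 'n) \<in> sphere 0 1" by simp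
  ultimately obtain v where v: "v \<in> sphere 0 1" and vmin: "\<And>z. z \<in> sphere 0 1 \<Longrightarrow> ?q v \<le> ?q z"
    using continuous_attains_inf[of "sphere 0 1 :: (real ^ 'n) set" ?q] compact_sphere by blast
  define l where "l = ?q v"
  have vv: "v \<bullet> v = 1" using v by (simp add: dot_square_norm)
  have ge: "l * (z \<bullet> z) \<le> ?q z" for z
  proof (cases "z = 0")
    case False
    have "l \<le> ?q ((1 / norm z) *\<^sub>R z)"
      unfolding l_def by (rule vmin) (simp add: False)
    also have "\<dots> = ?q z / (z \<bullet> z)"
      by (simp add: matrix_vector_mult_scaleR dot_square_norm power2_eq_square)
    finally show ?thesis using False by (simp add: field_simps)
  qed simp
  \<comment> \<open>The defect in the eigenvalue equation at \<open>v\<close>. Along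
    \<open>v + t *\<^sub>R h\<close>, \<open>ge\<close> says that a quadratic in \<open>t\<close>
    without constant term and with linear coefficient \<open>2 * (h \<bullet> h)\<close> is
    nonnegative, which forces \<open>h = 0\<close>.\<close>
  define h where "h = S *v v - l *\<^sub>R v"
  define K where "K = ?q h - l * (h \<bullet> h)"
  have K0: "K \<ge> 0" using ge[of h] by (simp add: K_def)
  have quad: "0 \<le> 2 * t * (h \<bullet> h) + t\<^sup>2 * K" for t
  proof -
    have "?q (v + t *\<^sub>R h) - l * ((v + t *\<^sub>R h) \<bullet> (v + t *\<^sub>R h))
        = 2 * t * (h \<bullet> (S *v v) - l * (h \<bullet> v)) + t\<^sup>2 * K"
      using inner_matrix_symmetric[OF sym, of v h] vv
      by (simp add: K_def l_def matrix_vector_right_distrib matrix_vector_mult_scaleR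
          inner_add_left inner_add_right inner_commute algebra_simps power2_eq_square)
    moreover have "h \<bullet> (S *v v) - l * (h \<bullet> v) = h \<bullet> h"
      by (simp add: h_def inner_diff_right)
    ultimately show ?thesis using ge[of "v + t *\<^sub>R h"] by simp
  qed
  have "h \<bullet> h \<le> 0"
  proof (rule ccontr)
    assume "\<not> h \<bullet> h \<le> 0"
    define n where "n = h \<bullet> h"
    \<comment> \<open>The denominator \<open>K + 1\<close> gives \<open>e * K \<le> n\<close> even
      for \<open>K = 0\<close>, so the quadratic at \<open>- e\<close> is at most
      \<open>- e * n < 0\<close>.\<close>
    define e where "e = n / (K + 1)"
    have n: "n > 0" using \<open>\<not> h \<bullet> h \<le> 0\<close> unfolding n_def by linarith
    have e: "e > 0" "e * K \<le> n" using n K0 by (auto simp: e_def field_simps)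
    have "0 \<le> e * (e * K - 2 * n)"
      using quad[of "- e"] by (simp add: n_def algebra_simps power2_eq_square)
    then have "0 \<le> e * K - 2 * n" using e by (simp add: zero_le_mult_iff)
    then show False using e n by linarith
  qed
  then have "h = 0" by (metis inner_gt_zero_iff not_less)
  then have "S *v v = l *\<^sub>R v" by (simp add: h_def)
  moreover have "v \<noteq> 0" using vv by auto
  ultimately show ?thesis unfolding eigvals_def by blast
qed

lemma lambda_min_pos:
  fixes S :: "real ^ 'n ^ 'n"
  assumes "sym_pos_def S"
  shows "lambda_min S > 0"
proof -
  have sym: "transpose S = S" using assms by (simp add: sym_pos_def_def)
  have "0 < l" if "l \<in> eigvals S" for l
  proof -
    from that obtain v where v: "v \<noteq> 0" "S *v v = l *\<^sub>R v" by (auto simp: eigvals_def)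
    then have "0 < l * (v \<bullet> v)" using assms unfolding sym_pos_def_def by (metis inner_scaleR_right)
    then show ?thesis using v zero_less_mult_pos2[of l "v \<bullet> v"] inner_gt_zero_iff[of v] by blast
  qed
  then show ?thesis
    unfolding lambda_min_def
    using finite_eigvals[OF sym] eigvals_nonempty[OF sym] by simp
qed

section \<open>Step sizes and weighted summation\<close>

lemma algorithm1_stepsize_bounds:
  assumes alg: "algorithm1 g f A B b S T \<beta> \<psi> \<mu> u x w y \<tau>"
  shows "\<exists>t > 0. \<forall>k. t \<le> \<tau> k \<and> \<tau> (Suc k) \<le> \<tau> k"
proof -
  obtain K where K: "K > 0" "\<And>z. norm (A *v z) \<le> K * norm z"
    using bounded_linear.pos_bounded[OF matrix_vector_mul_bounded_linear[of A]]
    by (metis mult.commute)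
  define s where "s = \<mu> * sqrt (lambda_min S) / sqrt \<beta>"
  have s: "s > 0"
    using alg lambda_min_pos[of S] unfolding s_def algorithm1_def
    by (intro divide_pos_pos mult_pos_pos) auto
  have step: "\<tau> (Suc k) = (if A *v x (Suc k) = A *v x k then \<tau> k else min (\<tau> k) (s / L_ratio A x (Suc k)))"
    for k
    using alg unfolding algorithm1_def s_def by (auto dest!: spec[of _ "Suc k"])
  have L: "s / K \<le> s / L_ratio A x (Suc k)" if "A *v x (Suc k) \<noteq> A *v x k" for k
  proof (rule divide_left_mono)
    have "x (Suc k) \<noteq> x k" using that by auto
    then show "L_ratio A x (Suc k) \<le> K" "0 < K * L_ratio A x (Suc k)"
      using K that K(2)[of "x (Suc k) - x k"]
      by (auto simp: L_ratio_def divide_simps matrix_vector_mult_diff_distrib)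
  qed (use s in simp)
  \<comment> \<open>Every new candidate in the step size rule is at least \<open>s / K\<close>, so
    this bound survives each step.\<close>
  define t where "t = min (\<tau> 0) (s / K)"
  have "t > 0" using alg K s unfolding algorithm1_def t_def by auto
  moreover have "t \<le> \<tau> k" for k
  proof (induction k)
    case (Suc k)
    then show ?case using L[of k] by (auto simp: step t_def)
  qed (simp add: t_def)
  ultimately show ?thesis by (auto simp: step)
qed

text \<open>Summation by parts, run as an induction with the sharper bound
  \<open>(D - F (Suc N)) / (2 * t N)\<close>. As \<open>F \<le> D\<close> and \<open>t\<close> is
  nonincreasing, passing from \<open>t n\<close> to \<open>t (Suc n)\<close> only enlarges it, and
  then the next difference telescopes.\<close>

lemma sum_scaled_differences_le:
  fixes d F t :: "nat \<Rightarrow> real"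
  assumes "m \<le> N" and "t0 > 0"
    and t: "\<And>k. t0 \<le> t k" "\<And>k. t (Suc k) \<le> t k"
    and F: "\<And>k. k \<ge> m \<Longrightarrow> 0 \<le> F k \<and> F k \<le> D"
    and d: "\<And>k. k \<ge> m \<Longrightarrow> 2 * t k * d k \<le> F k - F (Suc k)"
  shows "(\<Sum>k = m..N. d k) \<le> D / (2 * t0)"
proof -
  have pos: "t k > 0" for k using t(1)[of k] \<open>t0 > 0\<close> by linarith
  have d': "d k \<le> (F k - F (Suc k)) / (2 * t k)" if "k \<ge> m" for k
    using d[OF that] pos[of k] by (simp add: field_simps)
  have "(\<Sum>k = m..N. d k) \<le> (D - F (Suc N)) / (2 * t N)"
    using \<open>m \<le> N\<close>
  proof (induction rule: dec_induct)
    case base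
    have "(F m - F (Suc m)) / (2 * t m) \<le> (D - F (Suc m)) / (2 * t m)"
      using F[of m] pos[of m] by (intro divide_right_mono) auto
    then show ?case using d'[of m] by simp
  next
    case (step n)
    have "(D - F (Suc n)) / (2 * t n) \<le> (D - F (Suc n)) / (2 * t (Suc n))"
      using F[of "Suc n"] step pos t(2)[of n] by (intro divide_left_mono) auto
    then have "(\<Sum>k = m..Suc n. d k)
        \<le> (D - F (Suc n)) / (2 * t (Suc n)) + (F (Suc n) - F (Suc (Suc n))) / (2 * t (Suc n))"
      using step d'[of "Suc n"] by simp
    also have "\<dots> = (D - F (Suc (Suc n))) / (2 * t (Suc n))"
      by (simp flip: add_divide_distrib)
    finally show ?case .
  qed
  also have "\<dots> \<le> D / (2 * t N)"
    using F[of "Suc N"] \<open>m \<le> N\<close> pos[of N] by (intro divide_right_mono) auto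
  also have "\<dots> \<le> D / (2 * t0)"
    using F[of N] \<open>m \<le> N\<close> \<open>t0 > 0\<close> pos[of N] t(1)[of N] by (intro divide_left_mono) auto
  finally show ?thesis .
qed

section \<open>Averages and Jensen's inequality\<close>

lemma avg_eq_weighted_sum:
  "avg m z N = (\<Sum>k = m..N. (1 / real (N - m + 1)) *\<^sub>R z k)"
  by (simp add: avg_def scaleR_sum_right)

lemma avg_linear:
  assumes "linear L"
  shows "L (avg m z N) = avg m (\<lambda>k. L (z k)) N"
  by (simp add: avg_def linear_sum[OF assms] linear_cmul[OF assms])

lemma avg_const:
  assumes "m \<le> N"
  shows "avg m (\<lambda>_. a) N = a"
  using assms by (simp add: avg_def Suc_diff_le sum_constant_scaleR)

text \<open>The points \<open>(z k, r k)\<close> are averaged inside the convex epigraph, so no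
  extended-real sums arise.\<close>

lemma convex_fun_avg_le:
  assumes conv: "convex_fun h" and le: "\<And>k. k \<ge> m \<Longrightarrow> h (z k) \<le> ereal (r k)" and "m \<le> N"
  shows "h (avg m z N) \<le> ereal (avg m r N)"
proof -
  have "(\<Sum>k = m..N. (1 / real (N - m + 1)) *\<^sub>R (z k, r k)) \<in> ereal_epigraph h"
  proof (rule convex_sum)
    show "convex (ereal_epigraph h)" using conv by (simp add: convex_fun_def)
    show "(\<Sum>k = m..N. 1 / real (N - m + 1)) = 1"
      using \<open>m \<le> N\<close> by (simp add: Suc_diff_le)
  qed (use le in \<open>auto simp: ereal_epigraph_def\<close>)
  also have "(\<Sum>k = m..N. (1 / real (N - m + 1)) *\<^sub>R (z k, r k)) = (avg m z N, avg m r N)"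
    by (simp add: avg_eq_weighted_sum prod_eq_iff fst_sum snd_sum)
  finally show ?thesis by (simp add: ereal_epigraph_def)
qed

section \<open>Optimality of the saddle value\<close>

lemma saddle_point_optimal:
  assumes "proper_fun g" "proper_fun f" and sp: "saddle_point g f A B b xs ws ys"
  obtains P where "Phi_star g f A B b = ereal P" and "\<And>x w. ereal P \<le> Lagr g f A B b x w ys"
proof -
  have fin: "g x \<noteq> -\<infinity> \<and> f w \<noteq> -\<infinity>" for x w
    using assms by (auto simp: proper_fun_def)
  obtain x0 w0 where x0: "g x0 < \<infinity>" "f w0 < \<infinity>"
    using assms unfolding proper_fun_def effdom_def by blast
  have le1: "Lagr g f A B b xs ws v \<le> Lagr g f A B b xs ws ys" for v
    using sp unfolding saddle_point_def by blast
  have le2: "Lagr g f A B b xs ws ys \<le> Lagr g f A B b x w ys" for x w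
    using sp unfolding saddle_point_def by blast
  \<comment> \<open>By \<open>le2\<close> the saddle value lies below the finite Lagrangian at a
    point of both domains.\<close>
  have "Phi g f xs ws \<noteq> \<infinity>"
    using le2[of x0 w0] x0 fin[of xs ws] fin[of x0 w0]
    by (cases "g x0"; cases "f w0") (auto simp: Lagr_def Phi_def)
  moreover have "Phi g f xs ws \<noteq> -\<infinity>"
    using fin[of xs ws] by (cases "g xs"; cases "f ws") (auto simp: Phi_def)
  ultimately obtain P where P: "Phi g f xs ws = ereal P"
    by (cases "Phi g f xs ws") auto
  define r where "r = A *v xs + B *v ws - b"
  \<comment> \<open>Moving the multiplier along the residual shows that the saddle point is
    feasible.\<close>
  have "(ys + r) \<bullet> r \<le> ys \<bullet> r" using le1[of "ys + r"] P by (simp add: Lagr_def r_def)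
  then have "r \<bullet> r \<le> 0" by (simp add: inner_add_left)
  then have r: "r = 0" by (metis inner_gt_zero_iff not_less)
  then have feas: "(xs, ws) \<in> feasible A B b" by (simp add: feasible_def r_def)
  have low: "ereal P \<le> Lagr g f A B b x w ys" for x w
    using le2[of x w] P r by (simp add: Lagr_def[where x = xs] r_def)
  have "Phi_star g f A B b = ereal P"
    unfolding Phi_star_def
  proof (rule antisym)
    show "(INF (x, w)\<in>feasible A B b. Phi g f x w) \<le> ereal P"
      using INF_lower[OF feas, of "\<lambda>(x, w). Phi g f x w"] P by simp
    show "ereal P \<le> (INF (x, w)\<in>feasible A B b. Phi g f x w)"
    proof (rule INF_greatest, clarify)
      fix x w assume "(x, w) \<in> feasible A B b"
      then show "ereal P \<le> Phi g f x w"
        using low[of x w] by (simp add: Lagr_def feasible_def zero_ereal_def[symmetric])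
    qed
  qed
  then show ?thesis using low that by blast
qed

theorem theorem4p2:
  fixes g :: "real ^ 'q \<Rightarrow> ereal" and f :: "real ^ 'p \<Rightarrow> ereal"
    and A :: "real ^ 'q ^ 'm" and B :: "real ^ 'p ^ 'm" and b :: "real ^ 'm"
    and S :: "real ^ 'q ^ 'q" and T :: "real ^ 'p ^ 'p"
    and \<beta> \<psi> \<mu> c :: real
    and u x :: "nat \<Rightarrow> real ^ 'q" and w :: "nat \<Rightarrow> real ^ 'p" and y :: "nat \<Rightarrow> real ^ 'm"
    and \<tau> :: "nat \<Rightarrow> real"
    and xs :: "real ^ 'q" and ws :: "real ^ 'p" and ys :: "real ^ 'm"
    and k1 :: nat
  assumes "proper_fun g" and "closed_fun g" and "convex_fun g"
    and "proper_fun f" and "closed_fun f" and "convex_fun f"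
    and "standing_assumption g f A B b"
    and "algorithm1 g f A B b S T \<beta> \<psi> \<mu> u x w y \<tau>"
    and "saddle_point g f A B b xs ws ys"
    and "c > 0" and "c \<ge> 2 * norm ys"
    and "index_k1 g f A B b S T \<beta> \<psi> \<mu> u x w y \<tau> xs ws k1"
  shows "\<exists>C1 > 0. \<forall>N \<ge> k1.
    \<bar>Phi g f (avg k1 x N) (avg k1 w N) - Phi_star g f A B b\<bar> \<le> ereal (C1 / real (N - k1 + 1)) \<and>
    norm (A *v avg k1 x N + B *v avg k1 w N - b) \<le> 2 * C1 / (c * real (N - k1 + 1))"
proof -

  \<comment> \<open>Descent and boundedness of the potential\<close>
  note alg = assms(8) and idx = assms(12)
  obtain P where P: "Phi_star g f A B b = ereal P"
    and low: "\<And>x w. ereal P \<le> Lagr g f A B b x w ys"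
    using saddle_point_optimal[OF assms(1,4,9)] by blast
  obtain t where t: "t > 0" "\<And>k. t \<le> \<tau> k" "\<And>k. \<tau> (Suc k) \<le> \<tau> k"
    using algorithm1_stepsize_bounds[OF alg] by blast
  have tpos: "\<tau> k > 0" for k using t(1) t(2)[of k] by linarith
  have par: "\<beta> > 0" "\<psi> > 1" "\<mu> < 1"
  proof -
    \<comment> \<open>The golden ratio is thus at most 2, so
      \<open>\<mu> < \<psi> / 2 \<le> 1\<close>.\<close>
    have "sqrt 5 \<le> (3::real)" by (rule real_le_lsqrt) auto
    then show "\<beta> > 0" "\<psi> > 1" "\<mu> < 1" using alg unfolding algorithm1_def by auto
  qed
  define res where "res x' w' = A *v x' + B *v w' - b" for x' w'
  \<comment> \<open>The indices are shifted so that the telescoping terms of \<open>index_k1\<close>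
    are exactly \<open>F v k - F v (Suc k)\<close>.\<close>
  define F where "F v k = \<psi> / (\<psi> - 1) * (wnorm S (u (k + 1) - xs))\<^sup>2
    + (wnorm (\<tau> (k - 1) *\<^sub>R T) (ws - w (k - 1)))\<^sup>2 + 1 / \<beta> * (norm (v - y (k - 1)))\<^sup>2" for v k
  have main: "ereal (2 * \<tau> k) * (Lagr g f A B b (x k) (w k) v - ereal P) \<le> ereal (F v k - F v (Suc k))"
    if "k \<ge> k1" for k v
  proof -
    have drop: "p * (a - a') + (d - d') + q * (e - e') - z1 - z2 - z3
        \<le> (p * a + d + q * e) - (p * a' + d' + q * e')"
      if "0 \<le> z1" "0 \<le> z2" "0 \<le> z3" for p a a' d d' q e e' z1 z2 z3 :: real
      using that by (simp add: right_diff_distrib)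
    have FS: "F v (Suc k) = \<psi> / (\<psi> - 1) * (wnorm S (u (k + 2) - xs))\<^sup>2
        + (wnorm (\<tau> k *\<^sub>R T) (ws - w k))\<^sup>2 + 1 / \<beta> * (norm (v - y k))\<^sup>2"
      by (simp add: F_def)
    have pos: "0 \<le> 1 / \<beta> * (1 - \<mu>)" "0 \<le> \<psi> * \<tau> k / \<tau> (k - 1)"
      using par tpos[of k] tpos[of "k - 1"] by simp_all
    have "ereal (2 * \<tau> k) * (Lagr g f A B b (x k) (w k) v - ereal P) \<le> ereal (
          \<psi> / (\<psi> - 1) * ((wnorm S (u (k + 1) - xs))\<^sup>2 - (wnorm S (u (k + 2) - xs))\<^sup>2)
          + ((wnorm (\<tau> (k - 1) *\<^sub>R T) (ws - w (k - 1)))\<^sup>2 - (wnorm (\<tau> k *\<^sub>R T) (ws - w k))\<^sup>2)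
          + 1 / \<beta> * ((norm (v - y (k - 1)))\<^sup>2 - (norm (v - y k))\<^sup>2)
          - (wnorm (\<tau> k *\<^sub>R T) (w k - w (k - 1)))\<^sup>2
          - 1 / \<beta> * (1 - \<mu>) * (norm (y k - y (k - 1)))\<^sup>2
          - \<psi> * \<tau> k / \<tau> (k - 1) * (wnorm S (x k - u (k + 1)))\<^sup>2)"
      using idx that unfolding index_k1_def P by (elim conjE allE impE)
    also have "\<dots> \<le> ereal (F v k - F v (Suc k))"
      unfolding FS F_def[of v k] ereal_less_eq
      by (rule drop[OF _ mult_nonneg_nonneg[OF pos(1)] mult_nonneg_nonneg[OF pos(2)]]) simp_all
    finally show ?thesis .
  qed
  have nminf: "g x' \<noteq> -\<infinity> \<and> f w' \<noteq> -\<infinity>" for x' w'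
    using assms(1,4) by (auto simp: proper_fun_def)
  \<comment> \<open>An infinite value would make the left side of \<open>main\<close> infinite, as
    \<open>\<tau> k > 0\<close>, while its right side is real.\<close>
  have "\<exists>r s. k \<ge> k1 \<longrightarrow> g (x k) = ereal r \<and> f (w k) = ereal s" for k
    using main[of k 0] nminf[of "x k" "w k"] tpos[of k]
    by (cases "g (x k)"; cases "f (w k)") (auto simp: Lagr_def Phi_def)
  then obtain gr fr where gr: "\<And>k. k \<ge> k1 \<Longrightarrow> g (x k) = ereal (gr k)"
    and fr: "\<And>k. k \<ge> k1 \<Longrightarrow> f (w k) = ereal (fr k)"
    by metis
  define d where "d v k = gr k + fr k + v \<bullet> res (x k) (w k) - P" for v k
  have descent: "2 * \<tau> k * d v k \<le> F v k - F v (Suc k)" if "k \<ge> k1" for k v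
    using main[OF that, of v] by (simp add: gr fr that Lagr_def Phi_def res_def d_def)
  have Fge: "0 \<le> 1 / \<beta> * (norm (v - y (k - 1)))\<^sup>2 \<and> 1 / \<beta> * (norm (v - y (k - 1)))\<^sup>2 \<le> F v k" for v k
    using par by (simp add: F_def)
  \<comment> \<open>Only the last term of \<open>F\<close> depends on \<open>v\<close>; this carries
    the bound at \<open>ys\<close> over to other multipliers.\<close>
  have Fchange: "F v k \<le> F v' k + 1 / \<beta> * (norm (v - y (k - 1)))\<^sup>2" for v v' k
    using par by (simp add: F_def)
  have Fys: "F ys k \<le> F ys k1" if "k \<ge> k1" for k
    using that
  proof (induction rule: dec_induct)
    case (step n)
    have "0 \<le> d ys n"
      using low[of "x n" "w n"] step(1) by (simp add: d_def gr fr Lagr_def Phi_def res_def)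
    then have "0 \<le> 2 * \<tau> n * d ys n" using tpos[of n] by simp
    then show ?case using descent[OF step(1), of ys] step by linarith
  qed simp
  define E where "E = F ys k1"
  define R where "R = sqrt (\<beta> * E)"
  have E0: "E \<ge> 0" unfolding E_def using Fge[of ys k1] by linarith
  have yb: "norm (ys - y (k - 1)) \<le> R" if "k \<ge> k1" for k
  proof -
    have "1 / \<beta> * (norm (ys - y (k - 1)))\<^sup>2 \<le> E"
      using Fys[OF that] Fge[of ys k] unfolding E_def by linarith
    then have "(norm (ys - y (k - 1)))\<^sup>2 \<le> \<beta> * E" using par by (simp add: field_simps)
    then show ?thesis by (simp add: R_def real_le_rsqrt)
  qed
  \<comment> \<open>\<open>2 * c + R\<close> bounds the distance from \<open>v\<close> to
    \<open>y (k - 1)\<close> by way of \<open>ys\<close>, whose norm is at most \<open>c\<close>;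
    the summand 1 makes \<open>D\<close> positive.\<close>
  define D where "D = E + 1 / \<beta> * (2 * c + R)\<^sup>2 + 1"
  have Fbound: "0 \<le> F v k \<and> F v k \<le> D" if "norm v \<le> c" "k \<ge> k1" for v k
  proof -
    have "norm (v - y (k - 1)) \<le> norm v + norm ys + norm (ys - y (k - 1))"
      using norm_triangle_ineq[of "v - ys" "ys - y (k - 1)"] norm_triangle_ineq4[of v ys] by simp
    also have "\<dots> \<le> 2 * c + R" using that yb[of k] assms(10,11) norm_ge_zero[of ys] by linarith
    finally have "(norm (v - y (k - 1)))\<^sup>2 \<le> (2 * c + R)\<^sup>2" by (rule power_mono) simp
    then have "1 / \<beta> * (norm (v - y (k - 1)))\<^sup>2 \<le> 1 / \<beta> * (2 * c + R)\<^sup>2"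
      using par by (intro mult_left_mono) auto
    then show ?thesis
      using Fys[OF that(2)] Fge[of v k] Fchange[of v k ys] unfolding D_def E_def by linarith
  qed
  define C where "C = D / (2 * t)"
  have "D > 0" unfolding D_def using E0 par by (intro add_nonneg_pos add_nonneg_nonneg) auto
  then have C: "C > 0" using t(1) by (simp add: C_def)
  have sum_le: "(\<Sum>k = k1..N. d v k) \<le> C" if "norm v \<le> c" "N \<ge> k1" for v N
    unfolding C_def
    by (rule sum_scaled_differences_le[where t = \<tau> and F = "F v"])
      (use that t descent Fbound in auto)

  \<comment> \<open>Estimates at the averages\<close>
  show ?thesis
  proof (intro exI[of _ C] conjI allI impI C)
    fix N assume N: "N \<ge> k1"
    let ?n = "real (N - k1 + 1)"
    let ?x = "avg k1 x N" and ?w = "avg k1 w N"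
    define r where "r = res ?x ?w"
    have r_avg: "r = avg k1 (\<lambda>k. res (x k) (w k)) N"
    proof -
      have "r = avg k1 (\<lambda>k. A *v x k) N + avg k1 (\<lambda>k. B *v w k) N - avg k1 (\<lambda>_. b) N"
        by (simp add: r_def res_def avg_linear matrix_vector_mul_linear avg_const[OF N])
      then show ?thesis
        by (simp add: res_def avg_def sum.distrib sum_subtractf scaleR_diff_right scaleR_add_right)
    qed
    have dsum: "avg k1 gr N + avg k1 fr N + v \<bullet> r - P = (\<Sum>k = k1..N. d v k) / ?n" for v
    proof -
      have "v \<bullet> r = avg k1 (\<lambda>k. v \<bullet> res (x k) (w k)) N"
        unfolding r_avg by (rule avg_linear) (rule bounded_linear.linear[OF bounded_linear_inner_right])
      then have "avg k1 gr N + avg k1 fr N + v \<bullet> r - P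
          = avg k1 gr N + avg k1 fr N + avg k1 (\<lambda>k. v \<bullet> res (x k) (w k)) N - avg k1 (\<lambda>_. P) N"
        by (simp add: avg_const[OF N])
      also have "\<dots> = avg k1 (d v) N"
        by (simp add: avg_def d_def sum.distrib sum_subtractf right_diff_distrib distrib_left
            del: sum_constant)
      finally show ?thesis by (simp add: avg_def)
    qed
    have gle: "g ?x \<le> ereal (avg k1 gr N)" and fle: "f ?w \<le> ereal (avg k1 fr N)"
      using convex_fun_avg_le[OF assms(3), of k1 x gr N] convex_fun_avg_le[OF assms(6), of k1 w fr N]
        gr fr N by simp_all
    obtain ga fa where ga: "g ?x = ereal ga" and fa: "f ?w = ereal fa"
      using gle fle nminf[of ?x ?w] by (cases "g ?x"; cases "f ?w") auto
    have up: "ga + fa - P + v \<bullet> r \<le> C / ?n" if "norm v \<le> c" for v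
    proof -
      have "ga + fa - P + v \<bullet> r \<le> (\<Sum>k = k1..N. d v k) / ?n"
        using gle fle dsum[of v] by (simp add: ga fa)
      also have "\<dots> \<le> C / ?n" by (rule divide_right_mono[OF sum_le[OF that N]]) simp
      finally show ?thesis .
    qed
    have upr: "ga + fa - P + c * norm r \<le> C / ?n"
    proof -
      \<comment> \<open>This multiplier turns \<open>v \<bullet> r\<close> into
        \<open>c * norm r\<close>; \<open>sgn 0 = 0\<close> covers a vanishing residual.\<close>
      have "norm (c *\<^sub>R sgn r) \<le> c" using assms(10) by (simp add: norm_sgn)
      moreover have "(c *\<^sub>R sgn r) \<bullet> r = c * norm r"
        by (cases "r = 0") (simp_all add: sgn_div_norm dot_square_norm power2_eq_square)
      ultimately show ?thesis using up by metis
    qed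
    have lowr: "- (c / 2 * norm r) \<le> ga + fa - P"
    proof -
      have "P \<le> ga + fa + ys \<bullet> r"
        using low[of ?x ?w] by (simp add: Lagr_def Phi_def ga fa r_def res_def)
      moreover have "ys \<bullet> r \<le> norm ys * norm r" by (rule norm_cauchy_schwarz)
      moreover have "norm ys * norm r \<le> c / 2 * norm r"
        using assms(11) by (intro mult_right_mono) auto
      ultimately show ?thesis by linarith
    qed
    \<comment> \<open>Adding \<open>upr\<close> and \<open>lowr\<close> cancels the objective gap
      and leaves half of \<open>c * norm r\<close>. Inserted into \<open>lowr\<close>, this also
      bounds the gap from below.\<close>
    have half: "c / 2 * norm r \<le> C / ?n" using upr lowr by linarith
    have "0 \<le> c * norm r" using assms(10) by simp
    then have "\<bar>ga + fa - P\<bar> \<le> C / ?n" using upr lowr half by linarith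
    then show "\<bar>Phi g f ?x ?w - Phi_star g f A B b\<bar> \<le> ereal (C / ?n)"
      by (simp add: Phi_def ga fa P)
    show "norm (A *v ?x + B *v ?w - b) \<le> 2 * C / (c * ?n)"
    proof -
      have "norm r \<le> 2 * C / (c * q)" if "c / 2 * norm r \<le> C / q" "q > 0" for q
        using that assms(10) by (simp add: field_simps)
      from this[OF half] show ?thesis by (simp add: r_def res_def)
    qed
  qed
qed

end
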